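(* Let $H=\bigoplus_{i=1}^m H_i$ be the direct sum of separable real Hilbert spaces $H_1,\dots,H_m$, let $f\colon H\to\mathbb{R}$ be convex and differentiable, let $h_i\colon H_i\to\,]-\infty,+\infty]$ be proper, convex and lower semicontinuous for $i=1,\dots,m$, and set $h(x)=\sum_{i=1}^m h_i(x_i)$ and $F=f+h$. Let $\varepsilon=(\varepsilon_1,\dots,\varepsilon_m)$ be a $\{0,1\}^m$-valued random variable with $p_i:=\mathsf{P}(\varepsilon_i=1)>0$ for every $i$ and $\mathsf{P}(\varepsilon=(0,\dots,0))=0$, and let $(\varepsilon^n)_{n\in\mathbb{N}}$ be a sequence of independent copies of $\varepsilon$. Let $(\nu_i)_{1\le i\le m}\in\,]0,+\infty[^m$ be such that $$(\forall x,v\in H)\quad \mathsf{E}[f(x+\varepsilon\odot v)]\le f(x)+\mathsf{E}[\langle\nabla f(x),\varepsilon\odot v\rangle]+\frac12\sum_{i=1}^m p_i\nu_i\|v_i\|^2 .$$ Let $0<\gamma_i<2/\nu_i$ for every $i$, let $x^0\in\operatorname{dom}h$ be deterministic, and for $n\in\mathbb{N}$ define $$\bar x^{n+1}=\big(\mathrm{prox}_{\gamma_ih_i}(x_i^n-\gamma_i\nabla_if(x^n))\big)_{1\le i\le m},\qquad x^{n+1}=x^n+\varepsilon^n\odot(\bar x^{n+1}-x^n).$$ Set $\delta=\max_{i}\gamma_i\nu_i$ and $p_{\min}=\min_{i}p_i$, and let $\mu,\sigma\ge0$ be moduli of strong convexity of $f$ and $h$, respectively, in the norm $\|\cdot\|_{\Gamma^{-1}}$.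 Then, for every $n\in\mathbb{N}$ and every $x\in\operatorname{dom}F$, $\mathsf{P}$-a.s., $$(1+\sigma)\langle x^n-\bar x^{n+1},x-x^n\rangle_{\Gamma^{-1}}\le\frac1{p_{\min}}\mathsf{E}[F(x^n)-F(x^{n+1})\mid\mathfrak{E}_{n-1}]+\Big(F(x)-F(x^n)-\frac{\mu+\sigma}{2}\|x^n-x\|_{\Gamma^{-1}}^2\Big)+\frac{\delta-2-\sigma}{2}\|x^n-\bar x^{n+1}\|_{\Gamma^{-1}}^2 .$$
   Context: $H=\bigoplus_i H_i$ carries the inner product $\langle x,y\rangle=\sum_{i=1}^m\langle x_i,y_i\rangle$; $\nabla_i f(x)\in H_i$ is the $i$-th component of $\nabla f(x)$. For $v\in H$ and $\epsilon\in\{0,1\}^m$, $\epsilon\odot v=(\epsilon_iv_i)_{1\le i\le m}\in H$. For a proper convex lower semicontinuous function $\varphi$ on a Hilbert space, $\mathrm{prox}_\varphi(x)=\operatorname{argmin}_z\ \varphi(z)+\frac12\|x-z\|^2$. $\mathfrak{E}_{n-1}$ is the sigma-algebra generated by $\varepsilon^0,\dots,\varepsilon^{n-1}$ (the trivial one if $n=0$). The weighted inner product is $\langle x,y\rangle_{\Gamma^{-1}}=\sum_{i=1}^m\frac1{\gamma_i}\langle x_i,y_i\rangle$, with norm $\|\cdot\|_{\Gamma^{-1}}$. That $\mu,\sigma\ge0$ are moduli of strong convexity of $f$ and $h$ in the norm $\|\cdot\|_{\Gamma^{-1}}$ means that for all $x,y\in H$: $f(y)\ge f(x)+\langle\nabla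 f(x),y-x\rangle+\frac{\mu}{2}\|y-x\|_{\Gamma^{-1}}^2$ and, for every $v\in\partial h(x)$ (usual subdifferential), $h(y)\ge h(x)+\langle v,y-x\rangle+\frac{\sigma}{2}\|y-x\|_{\Gamma^{-1}}^2$. *)

theory Defs
  imports "HOL-Probability.Probability"
begin

text \<open>
  The spaces \<open>H i\<close> of a finite family may differ, whereas the components of a vector
  share one type. Each space is therefore a complete separable linear subspace of a common
  inner product space \<open>'a\<close> that is otherwise arbitrary (any finite family of Hilbert spaces is of
  this form up to isometry), and their direct sum is a subspace of \<open>'a ^ 'm\<close>, on
  which the library inner product is the sum of the componentwise ones. Functions on a space \<open>S\<close>
  are functions on the ambient type whose values outside \<open>S\<close> are irrelevant; \<open>S\<close> is passed to
  every notion below that quantifies over the space.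
\<close>

definition separable_hilbert :: "'a::real_inner set \<Rightarrow> bool" where
  "separable_hilbert S \<longleftrightarrow> subspace S \<and> Topological_Spaces.complete S \<and> separable_space (top_of_set S)"

definition hilbert_sum :: "('m::finite \<Rightarrow> 'a::real_inner set) \<Rightarrow> ('a ^ 'm) set" where
  "hilbert_sum H = {x. \<forall>i. x $ i \<in> H i}"

definition proper_on :: "'a set \<Rightarrow> ('a \<Rightarrow> ereal) \<Rightarrow> bool" where
  "proper_on S \<phi> \<longleftrightarrow> (\<forall>x\<in>S. \<phi> x \<noteq> -\<infinity>) \<and> (\<exists>x\<in>S. \<phi> x \<noteq> \<infinity>)"

definition econvex_on :: "'a::real_vector set \<Rightarrow> ('a \<Rightarrow> ereal) \<Rightarrow> bool" where
  "econvex_on S \<phi> \<longleftrightarrow> (\<forall>x\<in>S. \<forall>y\<in>S. \<forall>t\<in>{0<..<1}.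
     \<phi> ((1 - t) *\<^sub>R x + t *\<^sub>R y) \<le> ereal (1 - t) * \<phi> x + ereal t * \<phi> y)"

definition lsc_on :: "'a::topological_space set \<Rightarrow> ('a \<Rightarrow> ereal) \<Rightarrow> bool" where
  "lsc_on S \<phi> \<longleftrightarrow> (\<forall>x\<in>S. \<phi> x \<le> Liminf (at x within S) \<phi>)"

definition domain_on :: "'a set \<Rightarrow> ('a \<Rightarrow> ereal) \<Rightarrow> 'a set" where
  "domain_on S \<phi> = {x\<in>S. \<phi> x < \<infinity>}"

definition subdifferential_on :: "'a::real_inner set \<Rightarrow> ('a \<Rightarrow> ereal) \<Rightarrow> 'a \<Rightarrow> 'a set" where
  "subdifferential_on S \<phi> x = {v\<in>S. \<forall>y\<in>S. \<phi> x + ereal (v \<bullet> (y - x)) \<le> \<phi> y}"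

definition prox_on :: "'a::real_normed_vector set \<Rightarrow> ('a \<Rightarrow> ereal) \<Rightarrow> 'a \<Rightarrow> 'a" where
  "prox_on S \<phi> x = arg_min_on (\<lambda>z. \<phi> z + ereal (1/2 * (norm (x - z))\<^sup>2)) S"

text \<open>On a subspace \<open>S\<close>, the representative of the derivative within \<open>S\<close> is unique
  because it is required to lie in \<open>S\<close>.\<close>

definition gradient_on :: "'a::real_inner set \<Rightarrow> ('a \<Rightarrow> real) \<Rightarrow> 'a \<Rightarrow> 'a" where
  "gradient_on S f x = (THE g. g \<in> S \<and> (f has_derivative (\<lambda>d. g \<bullet> d)) (at x within S))"

definition winner :: "('m::finite \<Rightarrow> real) \<Rightarrow> 'a::real_inner ^ 'm \<Rightarrow> 'a ^ 'm \<Rightarrow> real" where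
  "winner \<gamma> x y = (\<Sum>i\<in>UNIV. 1 / \<gamma> i * (x $ i \<bullet> y $ i))"

definition wnorm :: "('m::finite \<Rightarrow> real) \<Rightarrow> 'a::real_inner ^ 'm \<Rightarrow> real" where
  "wnorm \<gamma> x = sqrt (winner \<gamma> x x)"

definition strong_convexity_modulus_smooth ::
  "('m::finite \<Rightarrow> real) \<Rightarrow> ('a::real_inner ^ 'm) set \<Rightarrow> ('a ^ 'm \<Rightarrow> real) \<Rightarrow> real \<Rightarrow> bool" where
  "strong_convexity_modulus_smooth \<gamma> S f \<mu> \<longleftrightarrow> 0 \<le> \<mu> \<and>
     (\<forall>x\<in>S. \<forall>y\<in>S. f y \<ge> f x + gradient_on S f x \<bullet> (y - x) + \<mu> / 2 * (wnorm \<gamma> (y - x))\<^sup>2)"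

definition strong_convexity_modulus ::
  "('m::finite \<Rightarrow> real) \<Rightarrow> ('a::real_inner ^ 'm) set \<Rightarrow> ('a ^ 'm \<Rightarrow> ereal) \<Rightarrow> real \<Rightarrow> bool" where
  "strong_convexity_modulus \<gamma> S h \<sigma> \<longleftrightarrow> 0 \<le> \<sigma> \<and>
     (\<forall>x\<in>S. \<forall>y\<in>S. \<forall>v\<in>subdifferential_on S h x.
        h y \<ge> h x + ereal (v \<bullet> (y - x)) + ereal (\<sigma> / 2 * (wnorm \<gamma> (y - x))\<^sup>2))"

definition zero_one_vectors :: "(real ^ 'm::finite) set" where
  "zero_one_vectors = {e. \<forall>i. e $ i \<in> {0, 1}}"

definition block_mult :: "real ^ 'm::finite \<Rightarrow> 'a::real_vector ^ 'm \<Rightarrow> 'a ^ 'm"  (infixr "\<odot>" 75)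
  where "e \<odot> v = (\<chi> i. e $ i *\<^sub>R v $ i)"

text \<open>The sigma-algebra generated by \<open>X 0, \<dots>, X (n - 1)\<close>; it is trivial for \<open>n = 0\<close>.\<close>

definition history :: "'w measure \<Rightarrow> 'b measure \<Rightarrow> (nat \<Rightarrow> 'w \<Rightarrow> 'b) \<Rightarrow> nat \<Rightarrow> 'w measure" where
  "history M N X n = sigma (space M) {X k -` A \<inter> space M |k A. k < n \<and> A \<in> sets N}"

end

theory Submission
  imports Defs
begin

text \<open>
  Conditionally on the past the iterate \<open>x\<close> is fixed and the next block selection is an independent
  copy of \<open>eps\<close>, so the conditional expectation is an average over selections. The smoothness
  assumption bounds the expected decrease of \<open>F\<close> below by \<open>\<Sum>i. p i * a i\<close>, where
  \<open>a i = h i (x i) - h i (q i) - \<langle>g i, q i - x i\<rangle> - \<nu> i / 2 * \<parallel>q i - x i\<parallel>\<^sup>2\<close> for the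
  proximal point \<open>q\<close> and the gradient \<open>g\<close> at \<open>x\<close>. Since \<open>(x - q) / \<gamma> - g\<close> is a subgradient of \<open>h\<close>
  at \<open>q\<close> and \<open>\<gamma> i < 2 / \<nu> i\<close>, each \<open>a i\<close> is nonnegative, so the weights \<open>p i\<close> may be replaced by
  \<open>pmin\<close>. The claim follows by adding the strong convexity inequalities of \<open>f\<close> at \<open>x\<close> and of
  \<open>h\<close> at \<open>q\<close>, the latter with this subgradient.

  Proximal points exist because a proper, lower semicontinuous, strongly convex function on a
  complete convex set is bounded below and its minimizing sequences are Cauchy; no affine
  minorant, hence no separation theorem, is needed.
\<close>

subsection \<open>Extended-real convex and lower semicontinuous functions\<close>

lemma domain_on_ereal:
  assumes "proper_on S \<phi>" "x \<in> domain_on S \<phi>"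
  shows "\<phi> x = ereal (real_of_ereal (\<phi> x))"
  using assms unfolding proper_on_def domain_on_def by (cases "\<phi> x") auto

lemma proper_on_cmult:
  assumes "proper_on S \<phi>" "0 < c"
  shows "proper_on S (\<lambda>z. ereal c * \<phi> z)"
  using assms unfolding proper_on_def by auto

lemma proper_on_add_real:
  assumes "proper_on S \<phi>"
  shows "proper_on S (\<lambda>z. \<phi> z + ereal (g z))"
  using assms unfolding proper_on_def by auto

lemma econvex_on_cmult:
  assumes "econvex_on S \<phi>" "proper_on S \<phi>" "0 < c"
  shows "econvex_on S (\<lambda>z. ereal c * \<phi> z)"
  unfolding econvex_on_def
proof (intro ballI)
  fix x y and t :: real
  assume xy: "x \<in> S" "y \<in> S" and t: "t \<in> {0<..<1}"
  have "ereal c * \<phi> ((1 - t) *\<^sub>R x + t *\<^sub>R y) \<le> ereal c * (ereal (1 - t) * \<phi> x + ereal t * \<phi> y)"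
    using assms xy t unfolding econvex_on_def by (intro ereal_mult_left_mono) auto
  also have "\<dots> = ereal (1 - t) * (ereal c * \<phi> x) + ereal t * (ereal c * \<phi> y)"
    using assms xy t unfolding proper_on_def
    by (cases "\<phi> x"; cases "\<phi> y") (auto simp: algebra_simps)
  finally show "ereal c * \<phi> ((1 - t) *\<^sub>R x + t *\<^sub>R y) \<le> \<dots>" .
qed

lemma lsc_on_iff_eventually_less:
  "lsc_on S \<phi> \<longleftrightarrow> (\<forall>x\<in>S. \<forall>b. ereal b < \<phi> x \<longrightarrow> (\<forall>\<^sub>F y in nhds x. y \<in> S \<longrightarrow> ereal b < \<phi> y))"
proof -
  have "\<phi> x \<le> Liminf (at x within S) \<phi>
      \<longleftrightarrow> (\<forall>b. ereal b < \<phi> x \<longrightarrow> (\<forall>\<^sub>F y in nhds x. y \<in> S \<longrightarrow> ereal b < \<phi> y))" (is "_ \<longleftrightarrow> (\<forall>b. ?near b)")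
    for x
  proof
    assume le_Liminf: "\<phi> x \<le> Liminf (at x within S) \<phi>"
    show "\<forall>b. ?near b"
    proof (intro allI impI)
      fix b assume b_less: "ereal b < \<phi> x"
      then have "\<forall>\<^sub>F y in at x within S. ereal b < \<phi> y"
        using le_Liminf unfolding le_Liminf_iff by blast
      then show "\<forall>\<^sub>F y in nhds x. y \<in> S \<longrightarrow> ereal b < \<phi> y"
        unfolding eventually_at_filter by (rule eventually_mono) (use b_less in auto)
    qed
  next
    assume near: "\<forall>b. ?near b"
    show "\<phi> x \<le> Liminf (at x within S) \<phi>"
      unfolding le_Liminf_iff
    proof (intro allI impI)
      fix l assume "l < \<phi> x"
      then obtain b where between: "l < ereal b" "ereal b < \<phi> x" using ereal_dense2 by blast
      then have "\<forall>\<^sub>F y in nhds x. y \<in> S \<longrightarrow> ereal b < \<phi> y" using near by blast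
      then show "\<forall>\<^sub>F y in at x within S. l < \<phi> y"
        unfolding eventually_at_filter by (rule eventually_mono) (use between(1) in auto)
    qed
  qed
  then show ?thesis unfolding lsc_on_def by simp
qed

lemma lsc_on_cmult:
  assumes "lsc_on S \<phi>" "0 < c"
  shows "lsc_on S (\<lambda>z. ereal c * \<phi> z)"
proof -
  have "ereal b < ereal c * v \<longleftrightarrow> ereal (b / c) < v" for b v
    using \<open>0 < c\<close> by (cases v) (auto simp: field_simps)
  then show ?thesis using assms(1) unfolding lsc_on_iff_eventually_less by simp
qed

lemma lsc_on_add_continuous:
  assumes lsc: "lsc_on S \<phi>" and g: "continuous_on S g"
  shows "lsc_on S (\<lambda>z. \<phi> z + ereal (g z))"
  unfolding lsc_on_iff_eventually_less
proof (intro ballI allI impI)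
  fix x b assume x: "x \<in> S" and "ereal b < \<phi> x + ereal (g x)"
  then have "ereal (b - g x) < \<phi> x" by (cases "\<phi> x") auto
  then obtain c where between: "b - g x < c" "ereal c < \<phi> x"
    using ereal_dense2 by (metis less_ereal.simps(1))
  then have "\<forall>\<^sub>F y in nhds x. y \<in> S \<longrightarrow> ereal c < \<phi> y"
    using lsc x unfolding lsc_on_iff_eventually_less by blast
  moreover have "(g \<longlongrightarrow> g x) (at x within S)" using g x unfolding continuous_on_def by blast
  then have "\<forall>\<^sub>F y in at x within S. b - c < g y" using between(1) by (intro order_tendstoD) auto
  then have "\<forall>\<^sub>F y in nhds x. y \<in> S \<longrightarrow> b - c < g y"
    unfolding eventually_at_filter by (rule eventually_mono) (use between(1) in auto)
  ultimately show "\<forall>\<^sub>F y in nhds x. y \<in> S \<longrightarrow> ereal b < \<phi> y + ereal (g y)"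
  proof eventually_elim
    case (elim y)
    then show ?case by (cases "\<phi> y") auto
  qed
qed

lemma lsc_on_le_of_LIMSEQ:
  assumes lsc: "lsc_on S \<phi>" and q: "q \<in> S" "z \<longlonglongrightarrow> q"
    and z: "\<And>n. z n \<in> S" "\<And>n. \<phi> (z n) \<le> ereal (a n)" and a: "a \<longlonglongrightarrow> l"
  shows "\<phi> q \<le> ereal l"
proof (rule ccontr)
  assume "\<not> \<phi> q \<le> ereal l"
  then obtain b where between: "l < b" "ereal b < \<phi> q"
    using ereal_dense2[of "ereal l" "\<phi> q"] by force
  then have "\<forall>\<^sub>F y in nhds q. y \<in> S \<longrightarrow> ereal b < \<phi> y"
    using lsc q(1) unfolding lsc_on_iff_eventually_less by blast
  then have "\<forall>\<^sub>F n in sequentially. z n \<in> S \<longrightarrow> ereal b < \<phi> (z n)"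
    using q(2) unfolding filterlim_iff by blast
  moreover have "\<forall>\<^sub>F n in sequentially. a n < b"
    using a between(1) by (rule order_tendstoD)
  ultimately have "\<forall>\<^sub>F n in sequentially. False"
  proof eventually_elim
    case (elim n)
    then have "ereal b < ereal (a n)" using z order_less_le_trans by blast
    then show False using elim(2) by simp
  qed
  then show False by simp
qed

subsection \<open>Strongly convex functions\<close>

definition strongly_econvex_on :: "'a::real_normed_vector set \<Rightarrow> real \<Rightarrow> ('a \<Rightarrow> ereal) \<Rightarrow> bool" where
  "strongly_econvex_on S \<kappa> \<Phi> \<longleftrightarrow> (\<forall>x\<in>S. \<forall>y\<in>S. \<forall>t\<in>{0<..<1}.
     \<Phi> ((1 - t) *\<^sub>R x + t *\<^sub>R y) + ereal (\<kappa> / 2 * t * (1 - t) * (norm (x - y))\<^sup>2)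
       \<le> ereal (1 - t) * \<Phi> x + ereal t * \<Phi> y)"

lemma strongly_econvex_onD:
  assumes strong: "strongly_econvex_on S \<kappa> \<Phi>" and xy: "x \<in> S" "y \<in> S" and t: "0 < t" "t < 1"
    and bounds: "\<Phi> x \<le> ereal a" "\<Phi> y \<le> ereal b"
  shows "\<Phi> ((1 - t) *\<^sub>R x + t *\<^sub>R y)
    \<le> ereal ((1 - t) * a + t * b - \<kappa> / 2 * t * (1 - t) * (norm (x - y))\<^sup>2)"
proof -
  have "\<Phi> ((1 - t) *\<^sub>R x + t *\<^sub>R y) + ereal (\<kappa> / 2 * t * (1 - t) * (norm (x - y))\<^sup>2)
      \<le> ereal (1 - t) * \<Phi> x + ereal t * \<Phi> y"
    using strong xy t unfolding strongly_econvex_on_def by simp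
  also have "\<dots> \<le> ereal (1 - t) * ereal a + ereal t * ereal b"
    using bounds t by (intro add_mono ereal_mult_left_mono) auto
  finally show ?thesis by (cases "\<Phi> ((1 - t) *\<^sub>R x + t *\<^sub>R y)") auto
qed

lemma Young_quotient_le:
  fixes \<kappa> r d :: real
  assumes "0 < \<kappa>" "0 < r"
  shows "2 * d / r \<le> 4 / (\<kappa> * r\<^sup>2) + \<kappa> / 4 * d\<^sup>2"
proof -
  have "4 / (\<kappa> * r\<^sup>2) + \<kappa> / 4 * d\<^sup>2 - 2 * d / r = \<kappa> / 4 * (d - 4 / (\<kappa> * r))\<^sup>2"
    using assms by (simp add: power2_eq_square field_simps)
  also have "0 \<le> \<dots>" using assms by simp
  finally show ?thesis by simp
qed

text \<open>If \<open>\<Phi> z\<close> were smaller, strong convexity on the segment from \<open>c\<close> to \<open>z\<close> would bring \<open>\<Phi>\<close> below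
  \<open>m - 1\<close> already at distance \<open>r / 2\<close> from \<open>c\<close>.\<close>

lemma strongly_econvex_on_lower_bound_from_ball:
  assumes S: "convex S" and strong: "strongly_econvex_on S \<kappa> \<Phi>" "0 < \<kappa>"
    and center: "c \<in> S" "\<Phi> c \<le> ereal m"
    and ball: "0 < r" "\<And>w. w \<in> S \<Longrightarrow> dist w c < r \<Longrightarrow> ereal (m - 1) < \<Phi> w" and z: "z \<in> S"
  shows "ereal (m - 1 - 4 / (\<kappa> * r\<^sup>2)) \<le> \<Phi> z"
proof (rule ccontr)
  define a where "a = m - 1 - 4 / (\<kappa> * r\<^sup>2)"
  define d where "d = norm (c - z)"
  define t where "t = r / (2 * d)"
  define w where "w = (1 - t) *\<^sub>R c + t *\<^sub>R z"
  assume "\<not> ereal (m - 1 - 4 / (\<kappa> * r\<^sup>2)) \<le> \<Phi> z"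
  then have below: "\<Phi> z < ereal a" by (simp add: a_def)
  also have "ereal a \<le> ereal (m - 1)" using ball(1) strong(2) by (simp add: a_def)
  finally have "r \<le> d" using ball(2)[OF z] by (force simp: d_def dist_norm norm_minus_commute)
  then have t: "0 < t" "t \<le> 1/2" and t_mult_d: "t * d = r / 2"
    using ball(1) by (auto simp: t_def field_simps)
  have "w - c = t *\<^sub>R (z - c)" by (simp add: w_def algebra_simps)
  then have "dist w c = t * d" using t by (simp add: dist_norm d_def norm_minus_commute)
  moreover have "w \<in> S" unfolding w_def using S center(1) z t by (intro convexD) auto
  ultimately have "ereal (m - 1) < \<Phi> w" using t_mult_d ball by simp
  also have "\<Phi> w \<le> ereal ((1 - t) * m + t * a - \<kappa> / 2 * t * (1 - t) * d\<^sup>2)"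
    unfolding w_def d_def
    using strongly_econvex_onD[OF strong(1) center(1) z _ _ center(2)] below t by simp
  finally have "t * (m - a) + \<kappa> / 2 * (1 - t) * (t * d\<^sup>2) < 1" by (simp add: algebra_simps)
  moreover have "\<kappa> / 2 * (1/2) * (t * d\<^sup>2) \<le> \<kappa> / 2 * (1 - t) * (t * d\<^sup>2)"
    using t strong(2) by (intro mult_right_mono mult_left_mono) auto
  ultimately have "t * (m - a) + \<kappa> / 2 * (1/2) * (t * d\<^sup>2) < 1" by linarith
  then have "t * (1 + 4 / (\<kappa> * r\<^sup>2) + \<kappa> / 4 * d\<^sup>2) < 1" by (simp add: a_def algebra_simps)
  moreover have "2 * d / r \<le> 4 / (\<kappa> * r\<^sup>2) + \<kappa> / 4 * d\<^sup>2"
    using strong(2) ball(1) by (rule Young_quotient_le)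
  then have "t * (1 + 2 * d / r) \<le> t * (1 + 4 / (\<kappa> * r\<^sup>2) + \<kappa> / 4 * d\<^sup>2)"
    using t by (intro mult_left_mono) auto
  moreover have "t * (1 + 2 * d / r) = t + 1" using t_mult_d ball(1) by (simp add: field_simps)
  ultimately show False using t by linarith
qed

lemma strongly_econvex_on_bounded_below:
  assumes "convex S" "proper_on S \<Phi>" "strongly_econvex_on S \<kappa> \<Phi>" "0 < \<kappa>" "lsc_on S \<Phi>"
  obtains b where "\<And>z. z \<in> S \<Longrightarrow> ereal b \<le> \<Phi> z"
proof -
  obtain c m where center: "c \<in> S" "\<Phi> c = ereal m"
    using assms(2) unfolding proper_on_def by (metis ereal_cases)
  then have "\<forall>\<^sub>F w in nhds c. w \<in> S \<longrightarrow> ereal (m - 1) < \<Phi> w"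
    using assms(5) unfolding lsc_on_iff_eventually_less by auto
  then obtain r where "0 < r" "\<And>w. w \<in> S \<Longrightarrow> dist w c < r \<Longrightarrow> ereal (m - 1) < \<Phi> w"
    unfolding eventually_nhds_metric by metis
  then show ?thesis
    using strongly_econvex_on_lower_bound_from_ball[OF assms(1,3,4)
        center(1) eq_refl[OF center(2)]] that
    by blast
qed

lemma strongly_econvex_on_near_minimizers:
  assumes S: "convex S" and strong: "strongly_econvex_on S \<kappa> \<Phi>"
    and m_lower: "\<And>z. z \<in> S \<Longrightarrow> ereal m \<le> \<Phi> z"
    and xy: "x \<in> S" "y \<in> S" and near: "\<Phi> x \<le> ereal (m + e)" "\<Phi> y \<le> ereal (m + e)"
  shows "\<kappa> * (norm (x - y))\<^sup>2 \<le> 8 * e"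
proof -
  let ?w = "(1 - 1/2) *\<^sub>R x + (1/2) *\<^sub>R y"
  have "?w \<in> S" using S xy by (intro convexD) auto
  then have "ereal m \<le> \<Phi> ?w" by (rule m_lower)
  also have "\<dots> \<le> ereal (m + e - \<kappa> / 8 * (norm (x - y))\<^sup>2)"
    using strongly_econvex_onD[OF strong xy _ _ near, of "1/2"] by simp
  finally show ?thesis by simp
qed

lemma strongly_econvex_on_minimizing_sequence_Cauchy:
  assumes S: "convex S" and strong: "strongly_econvex_on S \<kappa> \<Phi>" "0 < \<kappa>"
    and m_lower: "\<And>z. z \<in> S \<Longrightarrow> ereal m \<le> \<Phi> z"
    and z: "\<And>n. z n \<in> S" "\<And>n. \<Phi> (z n) \<le> ereal (m + a n)" and a: "a \<longlonglongrightarrow> 0"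
  shows "Cauchy z"
proof (rule metric_CauchyI)
  fix e :: real assume e: "0 < e"
  have "\<forall>\<^sub>F n in sequentially. a n < \<kappa> * e\<^sup>2 / 16"
    using a e strong(2) by (intro order_tendstoD) auto
  then obtain N where small: "\<And>n. N \<le> n \<Longrightarrow> a n < \<kappa> * e\<^sup>2 / 16"
    unfolding eventually_sequentially by blast
  have near: "\<Phi> (z n) \<le> ereal (m + \<kappa> * e\<^sup>2 / 16)" if "N \<le> n" for n
    using small[OF that] by (intro order_trans[OF z(2)]) simp
  have "dist (z i) (z j) < e" if "N \<le> i" "N \<le> j" for i j
  proof -
    have "\<kappa> * (norm (z i - z j))\<^sup>2 \<le> 8 * (\<kappa> * e\<^sup>2 / 16)"
      using strongly_econvex_on_near_minimizers[OF S strong(1) m_lower z(1) z(1) near near] that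
      by simp
    also have "\<dots> < \<kappa> * e\<^sup>2" using strong(2) e by simp
    finally show ?thesis using strong(2) e by (simp add: dist_norm power2_less_imp_less)
  qed
  then show "\<exists>N. \<forall>i\<ge>N. \<forall>j\<ge>N. dist (z i) (z j) < e" by blast
qed

lemma strongly_econvex_on_attains_min:
  assumes S: "convex S" "Topological_Spaces.complete S" and proper: "proper_on S \<Phi>"
    and strong: "strongly_econvex_on S \<kappa> \<Phi>" "0 < \<kappa>" and lsc: "lsc_on S \<Phi>"
  obtains q where "is_arg_min \<Phi> (\<lambda>z. z \<in> S) q"
proof -
  obtain b where b_lower: "\<And>z. z \<in> S \<Longrightarrow> ereal b \<le> \<Phi> z"
    using strongly_econvex_on_bounded_below[OF S(1) proper strong lsc] by metis
  obtain c where c_finite: "c \<in> S" "\<Phi> c \<noteq> \<infinity>" using proper unfolding proper_on_def by blast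
  have "ereal b \<le> Inf (\<Phi> ` S)" using b_lower by (intro INF_greatest)
  moreover have "Inf (\<Phi> ` S) \<le> \<Phi> c" using c_finite(1) by (rule INF_lower)
  ultimately obtain m where Inf_eq: "Inf (\<Phi> ` S) = ereal m"
    using c_finite(2) by (cases "Inf (\<Phi> ` S)") auto
  have m_lower: "ereal m \<le> \<Phi> z" if "z \<in> S" for z
    unfolding Inf_eq[symmetric] using that by (rule INF_lower)
  have "\<exists>z\<in>S. \<Phi> z < ereal (m + inverse (real (Suc n)))" for n
    unfolding INF_less_iff[symmetric] Inf_eq by simp
  then obtain z where z: "\<And>n. z n \<in> S" "\<And>n. \<Phi> (z n) \<le> ereal (m + inverse (real (Suc n)))"
    by (metis less_imp_le)
  have "Cauchy z"
    by (rule strongly_econvex_on_minimizing_sequence_Cauchy[OF S(1) strong m_lower z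
          LIMSEQ_inverse_real_of_nat])
  then obtain q where q: "q \<in> S" "z \<longlonglongrightarrow> q" using S(2) z(1) unfolding complete_def by blast
  have "(\<lambda>n. m + inverse (real (Suc n))) \<longlonglongrightarrow> m + 0"
    by (intro tendsto_intros LIMSEQ_inverse_real_of_nat)
  then have "\<Phi> q \<le> ereal (m + 0)" by (rule lsc_on_le_of_LIMSEQ[OF lsc q z])
  then show ?thesis
    using q(1) m_lower by (intro that[of q]) (auto simp: is_arg_min_linorder intro: order_trans)
qed

lemma strongly_econvex_on_arg_min_growth:
  assumes S: "convex S" and proper: "proper_on S \<Phi>" and strong: "strongly_econvex_on S \<kappa> \<Phi>"
    and q: "is_arg_min \<Phi> (\<lambda>z. z \<in> S) q" and y: "y \<in> S"
  shows "\<Phi> q + ereal (\<kappa> / 2 * (norm (q - y))\<^sup>2) \<le> \<Phi> y"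
proof (cases "\<Phi> y")
  case (real b)
  have qS: "q \<in> S" and q_le: "\<And>w. w \<in> S \<Longrightarrow> \<Phi> q \<le> \<Phi> w" using q by (auto simp: is_arg_min_linorder)
  obtain a where q_value: "\<Phi> q = ereal a"
    using proper qS q_le[OF y] real unfolding proper_on_def by (cases "\<Phi> q") auto
  have "s * (\<kappa> / 2 * (norm (q - y))\<^sup>2) \<le> b - a" if s: "0 < s" "s < 1" for s
  proof -
    let ?w = "(1 - (1 - s)) *\<^sub>R q + (1 - s) *\<^sub>R y"
    have "?w \<in> S" using S qS y s by (intro convexD) auto
    then have "\<Phi> q \<le> \<Phi> ?w" by (rule q_le)
    also have "\<dots> \<le> ereal (s * a + (1 - s) * b - \<kappa> / 2 * (1 - s) * s * (norm (q - y))\<^sup>2)"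
      using strongly_econvex_onD[OF strong qS y, of "1 - s" a b] s by (simp add: q_value real)
    finally have "(1 - s) * (s * (\<kappa> / 2 * (norm (q - y))\<^sup>2)) \<le> (1 - s) * (b - a)"
      by (simp add: q_value algebra_simps)
    then show ?thesis using s by simp
  qed
  then have "\<kappa> / 2 * (norm (q - y))\<^sup>2 \<le> b - a" by (rule field_le_mult_one_interval)
  then show ?thesis by (simp add: q_value real)
qed (use proper y in \<open>auto simp: proper_on_def\<close>)

lemma strongly_econvex_on_add_half_dist_sq:
  fixes u :: "'a::real_inner"
  assumes "econvex_on S \<phi>"
  shows "strongly_econvex_on S 1 (\<lambda>z. \<phi> z + ereal (1/2 * (norm (u - z))\<^sup>2))"
  unfolding strongly_econvex_on_def
proof (intro ballI)
  fix x y and t :: real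
  assume xy: "x \<in> S" "y \<in> S" and t: "t \<in> {0<..<1}"
  let ?w = "(1 - t) *\<^sub>R x + t *\<^sub>R y" and ?r = "\<lambda>z. 1/2 * (norm (u - z))\<^sup>2"
  have dist_split: "?r ?w + 1 / 2 * t * (1 - t) * (norm (x - y))\<^sup>2 = (1 - t) * ?r x + t * ?r y"
    unfolding power2_norm_eq_inner
    by (simp add: inner_diff_left inner_diff_right inner_add_left inner_add_right inner_commute
        field_simps)
  have "\<phi> ?w + ereal (?r ?w) + ereal (1 / 2 * t * (1 - t) * (norm (x - y))\<^sup>2)
      = \<phi> ?w + ereal ((1 - t) * ?r x + t * ?r y)"
    unfolding dist_split[symmetric] by (simp add: add.assoc)
  also have "\<dots> \<le> ereal (1 - t) * \<phi> x + ereal t * \<phi> y + ereal ((1 - t) * ?r x + t * ?r y)"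
    using assms xy t unfolding econvex_on_def by (intro add_right_mono) blast
  also have "\<dots> = ereal (1 - t) * (\<phi> x + ereal (?r x)) + ereal t * (\<phi> y + ereal (?r y))"
    using t by (cases "\<phi> x"; cases "\<phi> y") (auto simp: algebra_simps)
  finally show "\<phi> ?w + ereal (?r ?w) + ereal (1 / 2 * t * (1 - t) * (norm (x - y))\<^sup>2) \<le> \<dots>" .
qed

subsection \<open>Proximal operators and gradients on subspaces\<close>

context
  fixes S :: "'a::real_inner set" and \<phi> :: "'a \<Rightarrow> ereal"
  assumes S: "convex S" "Topological_Spaces.complete S"
    and \<phi>: "proper_on S \<phi>" "econvex_on S \<phi>" "lsc_on S \<phi>"
begin

lemma prox_on_is_arg_min:
  "is_arg_min (\<lambda>z. \<phi> z + ereal (1/2 * (norm (u - z))\<^sup>2)) (\<lambda>z. z \<in> S) (prox_on S \<phi> u)"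
proof -
  let ?\<Phi> = "\<lambda>z. \<phi> z + ereal (1/2 * (norm (u - z))\<^sup>2)"
  have "lsc_on S ?\<Phi>" by (intro lsc_on_add_continuous[OF \<phi>(3)] continuous_intros)
  then obtain q where "is_arg_min ?\<Phi> (\<lambda>z. z \<in> S) q"
    using strongly_econvex_on_attains_min[OF S proper_on_add_real[OF \<phi>(1)]
        strongly_econvex_on_add_half_dist_sq[OF \<phi>(2)]]
    by auto
  then show ?thesis
    unfolding prox_on_def arg_min_on_def arg_min_def by (rule someI)
qed

lemma prox_on_mem_domain: "prox_on S \<phi> u \<in> domain_on S \<phi>"
proof -
  let ?q = "prox_on S \<phi> u"
  obtain y where y_finite: "y \<in> S" "\<phi> y \<noteq> \<infinity>" using \<phi>(1) unfolding proper_on_def by blast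
  have q: "?q \<in> S"
    and "\<phi> ?q + ereal (1/2 * (norm (u - ?q))\<^sup>2) \<le> \<phi> y + ereal (1/2 * (norm (u - y))\<^sup>2)"
    using prox_on_is_arg_min[of u] y_finite(1) by (simp_all add: is_arg_min_linorder)
  then have "\<phi> ?q \<noteq> \<infinity>" using y_finite(2) by auto
  then show ?thesis using q by (simp add: domain_on_def)
qed

lemma prox_on_variational_inequality:
  assumes y: "y \<in> S"
  shows "\<phi> (prox_on S \<phi> u) + ereal ((u - prox_on S \<phi> u) \<bullet> (y - prox_on S \<phi> u)) \<le> \<phi> y"
proof -
  let ?q = "prox_on S \<phi> u"
  have growth: "\<phi> ?q + ereal (1/2 * (norm (u - ?q))\<^sup>2) + ereal (1/2 * (norm (?q - y))\<^sup>2)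
      \<le> \<phi> y + ereal (1/2 * (norm (u - y))\<^sup>2)"
    by (rule strongly_econvex_on_arg_min_growth[OF S(1) proper_on_add_real[OF \<phi>(1)]
          strongly_econvex_on_add_half_dist_sq[OF \<phi>(2)] prox_on_is_arg_min y])
  have "(u - ?q) \<bullet> (y - ?q)
      = 1/2 * (norm (u - ?q))\<^sup>2 + 1/2 * (norm (?q - y))\<^sup>2 - 1/2 * (norm (u - y))\<^sup>2"
    unfolding power2_norm_eq_inner
    by (simp add: inner_diff_left inner_diff_right inner_commute field_simps)
  then show ?thesis using growth by (cases "\<phi> ?q"; cases "\<phi> y") auto
qed

end

lemma prox_on_residual_mem_subdifferential:
  fixes S :: "'a::real_inner set"
  assumes S: "subspace S" "Topological_Spaces.complete S"
    and \<phi>: "proper_on S \<phi>" "econvex_on S \<phi>" "lsc_on S \<phi>" and u: "u \<in> S"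
  shows "u - prox_on S \<phi> u \<in> subdifferential_on S \<phi> (prox_on S \<phi> u)"
proof -
  note S' = subspace_imp_convex[OF S(1)] S(2)
  have "prox_on S \<phi> u \<in> S" using prox_on_mem_domain[OF S' \<phi>] by (simp add: domain_on_def)
  then show ?thesis
    using prox_on_variational_inequality[OF S' \<phi>] subspace_diff[OF S(1) u]
    unfolding subdifferential_on_def by blast
qed

lemma domain_on_cmult: "0 < c \<Longrightarrow> domain_on S (\<lambda>z. ereal c * \<phi> z) = domain_on S \<phi>"
  unfolding domain_on_def by (auto simp: ereal_mult_less_right)

lemma subdifferential_on_cmult:
  assumes "subspace S" "0 < c" "v \<in> subdifferential_on S (\<lambda>z. ereal c * \<phi> z) x"
  shows "(1 / c) *\<^sub>R v \<in> subdifferential_on S \<phi> x"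
  unfolding subdifferential_on_def
proof (intro CollectI conjI ballI)
  show "(1 / c) *\<^sub>R v \<in> S" using assms by (simp add: subdifferential_on_def subspace_scale)
  fix y assume "y \<in> S"
  then have "ereal c * \<phi> x + ereal (v \<bullet> (y - x)) \<le> ereal c * \<phi> y"
    using assms(3) by (simp add: subdifferential_on_def)
  then show "\<phi> x + ereal ((1 / c) *\<^sub>R v \<bullet> (y - x)) \<le> \<phi> y"
    using assms(2) by (cases "\<phi> x"; cases "\<phi> y") (auto simp: field_simps)
qed

lemma Riesz_representation_on:
  fixes f' :: "'a::real_inner \<Rightarrow> real"
  assumes S: "subspace S" "Topological_Spaces.complete S" and f': "bounded_linear f'"
  obtains g where "g \<in> S" "\<And>d. d \<in> S \<Longrightarrow> f' d = g \<bullet> d"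
proof -
  interpret bounded_linear f' by fact
  let ?\<phi> = "\<lambda>z. ereal (- f' z)"
  \<comment> \<open>the representing vector minimizes \<open>\<parallel>z\<parallel>\<^sup>2 / 2 - f' z\<close>\<close>
  define g where "g = prox_on S ?\<phi> 0"
  have \<phi>: "proper_on S ?\<phi>" "econvex_on S ?\<phi>" "lsc_on S ?\<phi>"
  proof -
    show "proper_on S ?\<phi>" using subspace_0[OF S(1)] unfolding proper_on_def by auto
    show "econvex_on S ?\<phi>" unfolding econvex_on_def by (simp add: add scaleR)
    have "lsc_on S (\<lambda>_. 0)" unfolding lsc_on_iff_eventually_less by simp
    from lsc_on_add_continuous[OF this, of "\<lambda>z. - f' z"] show "lsc_on S ?\<phi>"
      by (simp add: continuous_on linear_continuous_on bounded_linear_axioms continuous_on_minus)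
  qed
  have "0 - g \<in> subdifferential_on S ?\<phi> g"
    unfolding g_def by (rule prox_on_residual_mem_subdifferential[OF S \<phi> subspace_0[OF S(1)]])
  then have f'_le: "f' (y - g) \<le> g \<bullet> (y - g)" if "y \<in> S" for y
    using that by (force simp: subdifferential_on_def diff)
  have g_mem: "g \<in> S"
    using prox_on_mem_domain[OF subspace_imp_convex[OF S(1)] S(2) \<phi>]
    by (simp add: g_def domain_on_def)
  have "f' d = g \<bullet> d" if "d \<in> S" for d
    using f'_le[of "g + d"] f'_le[of "g - d"] g_mem that S(1)
    by (simp add: subspace_add subspace_diff neg)
  then show ?thesis using g_mem that by blast
qed

lemma has_derivative_within_subspace_cong:
  assumes f: "(f has_derivative f') (at x within S)" and S: "subspace S" "x \<in> S"
    and g: "bounded_linear g'" "\<And>d. d \<in> S \<Longrightarrow> f' d = g' d"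
  shows "(f has_derivative g') (at x within S)"
proof -
  have "((\<lambda>y. (f y - f x - f' (y - x)) /\<^sub>R norm (y - x)) \<longlongrightarrow> 0) (at x within S)"
    using f unfolding has_derivative_at_within by blast
  moreover have "f' (y - x) = g' (y - x)" if "y \<in> S" for y
    using g(2) subspace_diff[OF S(1) that S(2)] .
  then have "\<forall>\<^sub>F y in at x within S.
      (f y - f x - f' (y - x)) /\<^sub>R norm (y - x) = (f y - f x - g' (y - x)) /\<^sub>R norm (y - x)"
    unfolding eventually_at_filter by simp
  ultimately show ?thesis
    using g(1) unfolding has_derivative_at_within by (simp add: tendsto_cong)
qed

lemma gradient_within_subspace_unique:
  fixes g g' :: "'a::real_inner"
  assumes S: "subspace S" "x \<in> S" and g: "g \<in> S" "(f has_derivative (\<lambda>d. g \<bullet> d)) (at x within S)"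
    and g': "g' \<in> S" "(f has_derivative (\<lambda>d. g' \<bullet> d)) (at x within S)"
  shows "g = g'"
proof -
  define v where "v = g - g'"
  let ?line = "\<lambda>t::real. x + t *\<^sub>R v"
  have "range ?line \<subseteq> S"
    using S g(1) g'(1) by (auto simp: v_def intro!: subspace_add subspace_scale subspace_diff)
  moreover have "(?line has_derivative (\<lambda>t. t *\<^sub>R v)) (at 0)"
    by (auto intro!: derivative_eq_intros)
  ultimately have "(f \<circ> ?line has_derivative (\<lambda>t. k \<bullet> (t *\<^sub>R v))) (at 0)"
    if "(f has_derivative (\<lambda>d. k \<bullet> d)) (at x within S)" for k
    using has_derivative_in_compose[of ?line "\<lambda>t. t *\<^sub>R v" 0 UNIV f "\<lambda>d. k \<bullet> d"]
      has_derivative_subset[OF that] by (simp add: o_def)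
  then have "(\<lambda>t. g \<bullet> (t *\<^sub>R v)) = (\<lambda>t. g' \<bullet> (t *\<^sub>R v))"
    using g(2) g'(2) has_derivative_unique by blast
  from fun_cong[OF this, of 1] have "v \<bullet> v = 0" by (simp add: v_def inner_diff_left)
  then show ?thesis by (simp add: v_def)
qed

lemma gradient_on_mem:
  assumes S: "subspace S" "Topological_Spaces.complete S" "x \<in> S"
    and f: "f differentiable (at x within S)"
  shows "gradient_on S f x \<in> S"
proof -
  obtain f' where f': "(f has_derivative f') (at x within S)"
    using f by (auto simp: differentiable_def)
  obtain g where g: "g \<in> S" "\<And>d. d \<in> S \<Longrightarrow> f' d = g \<bullet> d"
    using Riesz_representation_on[OF S(1,2) has_derivative_bounded_linear[OF f']] by blast
  have "(f has_derivative (\<lambda>d. g \<bullet> d)) (at x within S)"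
    using has_derivative_within_subspace_cong[OF f' S(1,3) bounded_linear_inner_right g(2)] .
  then have "\<exists>!g. g \<in> S \<and> (f has_derivative (\<lambda>d. g \<bullet> d)) (at x within S)"
    using g(1) gradient_within_subspace_unique[OF S(1,3)] by blast
  from theI'[OF this] show ?thesis unfolding gradient_on_def by blast
qed

subsection \<open>Conditioning on the history of an independent sequence\<close>

lemma space_history: "space (history M N X n) = space M"
  unfolding history_def by (intro space_measure_of) auto

lemma sets_history:
  "sets (history M N X n) = sigma_sets (space M) {X k -` A \<inter> space M |k A. k < n \<and> A \<in> sets N}"
  unfolding history_def by (intro sets_measure_of) auto

lemma subalgebra_history:
  assumes "\<And>k. X k \<in> measurable M N"
  shows "subalgebra M (history M N X n)"
  unfolding subalgebra_def space_history sets_history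
  using assms by (auto intro!: sets.sigma_sets_subset measurable_sets)

lemma subalgebra_history_mono:
  assumes "m \<le> n"
  shows "subalgebra (history M N X n) (history M N X m)"
  unfolding subalgebra_def space_history sets_history
  using assms by (intro conjI refl sigma_sets_mono') fastforce

lemma measurable_history:
  assumes "X k \<in> measurable M N" "k < n"
  shows "X k \<in> measurable (history M N X n) N"
proof (rule measurableI)
  fix A assume "A \<in> sets N"
  then show "X k -` A \<inter> space (history M N X n) \<in> sets (history M N X n)"
    unfolding space_history sets_history using assms(2) by (intro sigma_sets.Basic) blast
qed (use measurable_space[OF assms(1)] in \<open>auto simp: space_history\<close>)

lemma (in prob_space) indep_set_history:
  assumes indep: "indep_vars (\<lambda>_. N) X UNIV"
  shows "indep_set (sets (history M N X n))
    (sigma_sets (space M) {X n -` A \<inter> space M |A. A \<in> sets N})"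
proof -
  let ?E = "\<lambda>i. {X i -` A \<inter> space M |A. A \<in> sets N}" and ?I = "case_bool {..<n} {n}"
  have "indep_sets (\<lambda>j. sigma_sets (space M) (\<Union>i\<in>?I j. ?E i)) UNIV"
  proof (rule indep_sets_collect_sigma)
    have "indep_sets ?E UNIV" using indep unfolding indep_vars_def2 by auto
    then show "indep_sets ?E (\<Union>j\<in>UNIV. ?I j)" by (rule indep_sets_mono_index[rotated]) simp
    show "disjoint_family_on ?I UNIV"
      unfolding disjoint_family_on_def by (auto split: bool.split)
    show "Int_stable (?E i)" for i
    proof (rule Int_stableI)
      fix a b assume "a \<in> ?E i" "b \<in> ?E i"
      then obtain A B where "a = X i -` A \<inter> space M" "b = X i -` B \<inter> space M"
          "A \<in> sets N" "B \<in> sets N"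
        by auto
      then show "a \<inter> b \<in> ?E i" by (intro CollectI exI[of _ "A \<inter> B"]) auto
    qed
  qed
  moreover have "sets (history M N X n) = sigma_sets (space M) (\<Union>i<n. ?E i)"
    unfolding sets_history by (rule arg_cong[where f = "sigma_sets (space M)"]) auto
  then have "(\<lambda>j. sigma_sets (space M) (\<Union>i\<in>?I j. ?E i))
      = case_bool (sets (history M N X n)) (sigma_sets (space M) (?E n))"
    by (simp add: fun_eq_iff split: bool.split)
  ultimately show ?thesis unfolding indep_set_def by simp
qed

lemma (in prob_space) pair_measure_eq_distr_of_indep_set:
  assumes sub: "subalgebra M F" and X: "X \<in> measurable M N"
    and indep: "indep_set (sets F) (sigma_sets (space M) {X -` A \<inter> space M |A. A \<in> sets N})"
  shows "distr M F (\<lambda>\<omega>. \<omega>) \<Otimes>\<^sub>M distr M N X = distr M (F \<Otimes>\<^sub>M N) (\<lambda>\<omega>. (\<omega>, X \<omega>))"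
proof (rule pair_measure_eqI)
  have id: "(\<lambda>\<omega>. \<omega>) \<in> measurable M F" by (rule measurable_from_subalg[OF sub]) simp
  show "sigma_finite_measure (distr M F (\<lambda>\<omega>. \<omega>))" "sigma_finite_measure (distr M N X)"
    using prob_space_distr[OF id] prob_space_distr[OF X]
    by (auto intro: prob_space_imp_sigma_finite)
  fix A B assume "A \<in> sets (distr M F (\<lambda>\<omega>. \<omega>))" "B \<in> sets (distr M N X)"
  then have A: "A \<in> sets F" and B: "B \<in> sets N" by simp_all
  have "(\<lambda>\<omega>. \<omega>) -` A \<inter> space M = A"
    using sets.sets_into_space[OF A] sub by (auto simp: subalgebra_def)
  moreover have "(\<lambda>\<omega>. (\<omega>, X \<omega>)) -` (A \<times> B) \<inter> space M = A \<inter> (X -` B \<inter> space M)" by auto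
  moreover have "prob (A \<inter> (X -` B \<inter> space M)) = prob A * prob (X -` B \<inter> space M)"
    using B by (intro indep_setD[OF indep A]) auto
  ultimately show "emeasure (distr M F (\<lambda>\<omega>. \<omega>)) A * emeasure (distr M N X) B
      = emeasure (distr M (F \<Otimes>\<^sub>M N) (\<lambda>\<omega>. (\<omega>, X \<omega>))) (A \<times> B)"
    using A B id X by (simp add: emeasure_distr emeasure_eq_measure ennreal_mult)
qed simp

text \<open>Integrating over a set of \<open>F\<close> amounts, by independence, to integrating over the product of \<open>M\<close>
  and the distribution of \<open>X\<close>, and Fubini's theorem applies.\<close>

lemma (in prob_space) real_cond_exp_indep_set:
  fixes G :: "'a \<times> 'b \<Rightarrow> real"
  assumes sub: "subalgebra M F" and X: "X \<in> measurable M N"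
    and indep: "indep_set (sets F) (sigma_sets (space M) {X -` A \<inter> space M |A. A \<in> sets N})"
    and G: "G \<in> borel_measurable (F \<Otimes>\<^sub>M N)" and integrable: "integrable M (\<lambda>\<omega>. G (\<omega>, X \<omega>))"
  shows "AE \<omega> in M. real_cond_exp M F (\<lambda>\<omega>. G (\<omega>, X \<omega>)) \<omega> = (\<integral>y. G (\<omega>, y) \<partial>distr M N X)"
proof -
  interpret finite_measure_subalgebra M F by standard (rule sub)
  let ?P = "distr M F (\<lambda>\<omega>. \<omega>)" and ?Q = "distr M N X"
  have id: "(\<lambda>\<omega>. \<omega>) \<in> measurable M F" by (rule measurable_from_subalg[OF sub]) simp
  interpret P: prob_space ?P by (rule prob_space_distr[OF id])
  interpret Q: prob_space ?Q by (rule prob_space_distr[OF X])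
  interpret PQ: pair_prob_space ?P ?Q ..
  have pair: "(\<lambda>\<omega>. (\<omega>, X \<omega>)) \<in> measurable M (F \<Otimes>\<^sub>M N)" using id X by simp
  note prod = pair_measure_eq_distr_of_indep_set[OF sub X indep]
  have G_integrable: "integrable (?P \<Otimes>\<^sub>M ?Q) G"
    unfolding prod using integrable by (simp add: integrable_distr_eq[OF pair G])
  show ?thesis
  proof (rule real_cond_exp_charact[OF _ integrable])
    show meas: "(\<lambda>\<omega>. \<integral>y. G (\<omega>, y) \<partial>?Q) \<in> borel_measurable F"
      using G by simp
    show "integrable M (\<lambda>\<omega>. \<integral>y. G (\<omega>, y) \<partial>?Q)"
      using PQ.integrable_fst'[OF G_integrable] meas by (simp add: integrable_distr_eq[OF id])
    fix A assume A[measurable]: "A \<in> sets F"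
    let ?GA = "\<lambda>p. indicator A (fst p) * G p"
    have GA_measurable: "?GA \<in> borel_measurable (F \<Otimes>\<^sub>M N)" using G by simp
    have "integrable (?P \<Otimes>\<^sub>M ?Q) ?GA"
      by (rule Bochner_Integration.integrable_bound[OF G_integrable])
        (use GA_measurable in \<open>auto simp: indicator_def\<close>)
    then have "(\<integral>p. ?GA p \<partial>(?P \<Otimes>\<^sub>M ?Q)) = (\<integral>\<omega>. (\<integral>y. ?GA (\<omega>, y) \<partial>?Q) \<partial>?P)"
      by (rule PQ.integral_fst'[symmetric])
    then show "(\<integral>\<omega>\<in>A. G (\<omega>, X \<omega>) \<partial>M) = (\<integral>\<omega>\<in>A. (\<integral>y. G (\<omega>, y) \<partial>?Q) \<partial>M)"
      unfolding prod set_lebesgue_integral_def using meas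
      by (simp add: integral_distr[OF pair GA_measurable] integral_distr[OF id])
  qed
qed

lemma (in prob_space) integrable_finite_rv:
  fixes \<phi> :: "'b \<Rightarrow> real"
  assumes "X \<in> measurable M (count_space E)" "finite E"
  shows "integrable M (\<lambda>\<omega>. \<phi> (X \<omega>))"
proof (rule integrable_const_bound[where B = "Max ((\<lambda>e. norm (\<phi> e)) ` E)"])
  show "AE \<omega> in M. norm (\<phi> (X \<omega>)) \<le> Max ((\<lambda>e. norm (\<phi> e)) ` E)"
    using measurable_space[OF assms(1)] assms(2) by (intro AE_I2 Max_ge) auto
  show "(\<lambda>\<omega>. \<phi> (X \<omega>)) \<in> borel_measurable M"
    by (rule measurable_compose[OF assms(1)]) simp
qed

lemma measurable_Pair_count_space_finite:
  assumes "X \<in> measurable M (count_space A)" "Y \<in> measurable M (count_space B)"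
    and "finite A" "finite B"
  shows "(\<lambda>\<omega>. (X \<omega>, Y \<omega>)) \<in> measurable M (count_space (A \<times> B))"
  using assms by (simp add: pair_measure_count_space[symmetric])

locale random_recursion = prob_space M for M :: "'w measure" +
  fixes E :: "'e set" and X :: "nat \<Rightarrow> 'w \<Rightarrow> 'e" and \<Phi> :: "'s \<Rightarrow> 'e \<Rightarrow> 's"
    and x :: "nat \<Rightarrow> 'w \<Rightarrow> 's" and s\<^sub>0 :: 's
  assumes finite_noise: "finite E"
    and indep_noise: "indep_vars (\<lambda>_. count_space E) X UNIV"
    and x_0: "\<And>\<omega>. \<omega> \<in> space M \<Longrightarrow> x 0 \<omega> = s\<^sub>0"
    and x_Suc: "\<And>n \<omega>. \<omega> \<in> space M \<Longrightarrow> x (Suc n) \<omega> = \<Phi> (x n \<omega>) (X n \<omega>)"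
begin

lemma measurable_noise: "X n \<in> measurable M (count_space E)"
  using indep_noise unfolding indep_vars_def by auto

lemma state_mem_invariant:
  assumes "s\<^sub>0 \<in> D" "\<And>s e. s \<in> D \<Longrightarrow> e \<in> E \<Longrightarrow> \<Phi> s e \<in> D" "\<omega> \<in> space M"
  shows "x n \<omega> \<in> D"
  using assms measurable_space[OF measurable_noise]
  by (induction n) (auto simp: x_0 x_Suc)

lemma finite_state_measurable_history:
  obtains R where "finite R" "x n \<in> measurable (history M (count_space E) X n) (count_space R)"
proof (induction n arbitrary: thesis)
  case 0
  have "(\<lambda>_. s\<^sub>0) \<in> measurable (history M (count_space E) X 0) (count_space {s\<^sub>0})" by simp
  then have "x 0 \<in> measurable (history M (count_space E) X 0) (count_space {s\<^sub>0})"
    by (rule measurable_cong[THEN iffD1, rotated]) (simp add: space_history x_0)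
  then show ?case using 0 by blast
next
  case (Suc n)
  let ?F = "\<lambda>n. history M (count_space E) X n"
  obtain R where R: "finite R" "x n \<in> measurable (?F n) (count_space R)" by (rule Suc.IH)
  let ?R = "(\<lambda>(s, e). \<Phi> s e) ` (R \<times> E)"
  have "x n \<in> measurable (?F (Suc n)) (count_space R)"
    by (rule measurable_from_subalg[OF subalgebra_history_mono R(2)]) simp
  moreover have "X n \<in> measurable (?F (Suc n)) (count_space E)"
    by (rule measurable_history[OF measurable_noise]) simp
  ultimately have "(\<lambda>\<omega>. (x n \<omega>, X n \<omega>)) \<in> measurable (?F (Suc n)) (count_space (R \<times> E))"
    by (rule measurable_Pair_count_space_finite[OF _ _ R(1) finite_noise])
  then have "(\<lambda>\<omega>. case (x n \<omega>, X n \<omega>) of (s, e) \<Rightarrow> \<Phi> s e) \<in> measurable (?F (Suc n)) (count_space ?R)"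
    by (rule measurable_compose) auto
  then have "x (Suc n) \<in> measurable (?F (Suc n)) (count_space ?R)"
    by (rule measurable_cong[THEN iffD1, rotated]) (simp add: space_history x_Suc)
  moreover have "finite ?R" using R(1) finite_noise by simp
  ultimately show ?case using Suc.prems by blast
qed

lemma real_cond_exp_transition:
  fixes \<Psi> :: "'s \<Rightarrow> 's \<Rightarrow> real"
  shows "AE \<omega> in M.
    real_cond_exp M (history M (count_space E) X n) (\<lambda>\<omega>'. \<Psi> (x n \<omega>') (x (Suc n) \<omega>')) \<omega>
    = (\<integral>e. \<Psi> (x n \<omega>) (\<Phi> (x n \<omega>) e) \<partial>distr M (count_space E) (X n))"
proof -
  let ?F = "history M (count_space E) X n"
  have sub: "subalgebra M ?F" by (rule subalgebra_history[OF measurable_noise])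
  interpret finite_measure_subalgebra M ?F by standard (rule sub)
  obtain R where R: "finite R" "x n \<in> measurable ?F (count_space R)"
    by (rule finite_state_measurable_history)
  let ?G = "\<lambda>(\<omega>, e). \<Psi> (x n \<omega>) (\<Phi> (x n \<omega>) e)"
  have "(\<lambda>p. (x n (fst p), snd p)) \<in> measurable (?F \<Otimes>\<^sub>M count_space E) (count_space (R \<times> E))"
    using R(2) by (intro measurable_Pair_count_space_finite[OF _ _ R(1) finite_noise]) simp_all
  then have "(\<lambda>p. case (x n (fst p), snd p) of (s, e) \<Rightarrow> \<Psi> s (\<Phi> s e))
      \<in> borel_measurable (?F \<Otimes>\<^sub>M count_space E)"
    by (rule measurable_compose) simp
  then have G_measurable: "?G \<in> borel_measurable (?F \<Otimes>\<^sub>M count_space E)"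
    by (simp add: case_prod_unfold)
  have "(\<lambda>\<omega>. (x n \<omega>, X n \<omega>)) \<in> measurable M (count_space (R \<times> E))"
    by (rule measurable_Pair_count_space_finite[OF measurable_from_subalg[OF sub R(2)]
          measurable_noise R(1) finite_noise])
  from integrable_finite_rv[OF this, of "\<lambda>(s, e). \<Psi> s (\<Phi> s e)"]
  have integrable: "integrable M (\<lambda>\<omega>. ?G (\<omega>, X n \<omega>))" using R(1) finite_noise by simp
  have "AE \<omega> in M. real_cond_exp M ?F (\<lambda>\<omega>'. ?G (\<omega>', X n \<omega>')) \<omega>
      = (\<integral>e. ?G (\<omega>, e) \<partial>distr M (count_space E) (X n))"
    by (rule real_cond_exp_indep_set[OF sub measurable_noise
          indep_set_history[OF indep_noise] G_measurable integrable])
  moreover have "AE \<omega> in M. real_cond_exp M ?F (\<lambda>\<omega>'. \<Psi> (x n \<omega>') (x (Suc n) \<omega>')) \<omega>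
      = real_cond_exp M ?F (\<lambda>\<omega>'. ?G (\<omega>', X n \<omega>')) \<omega>"
  proof (rule real_cond_exp_cong)
    show meas: "(\<lambda>\<omega>. ?G (\<omega>, X n \<omega>)) \<in> borel_measurable M" using integrable by simp
    show "(\<lambda>\<omega>. \<Psi> (x n \<omega>) (x (Suc n) \<omega>)) \<in> borel_measurable M"
      by (rule measurable_cong[THEN iffD1, OF _ meas]) (simp add: x_Suc)
  qed (auto simp: x_Suc)
  ultimately show ?thesis by eventually_elim simp
qed

end

subsection \<open>Weighted norms and block selections on direct sums\<close>

lemma subspace_hilbert_sum:
  assumes "\<And>i. subspace (H i)"
  shows "subspace (hilbert_sum H)"
  using assms unfolding subspace_def hilbert_sum_def by auto

lemma complete_hilbert_sum:
  fixes H :: "'m::finite \<Rightarrow> 'a::real_inner set"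
  assumes "\<And>i. Topological_Spaces.complete (H i)"
  shows "Topological_Spaces.complete (hilbert_sum H)"
  unfolding complete_def
proof (intro allI impI)
  fix s :: "nat \<Rightarrow> 'a ^ 'm" assume "(\<forall>n. s n \<in> hilbert_sum H) \<and> Cauchy s"
  then have "\<exists>l\<in>H i. (\<lambda>n. s n $ i) \<longlonglongrightarrow> l" for i
    using assms[of i] Cauchy_vec_nth[of s i] unfolding complete_def hilbert_sum_def by simp
  then obtain l where l: "\<And>i. l i \<in> H i" "\<And>i. (\<lambda>n. s n $ i) \<longlonglongrightarrow> l i" by metis
  have "s \<longlonglongrightarrow> (\<chi> i. l i)" by (rule vec_tendstoI) (simp add: l)
  then show "\<exists>l\<in>hilbert_sum H. s \<longlonglongrightarrow> l"
    using l(1) by (intro bexI[of _ "\<chi> i. l i"]) (auto simp: hilbert_sum_def)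
qed

lemma mem_domain_on_hilbert_sum_iff:
  "y \<in> domain_on (hilbert_sum H) (\<lambda>z. \<Sum>i\<in>UNIV. h i (z $ i)) \<longleftrightarrow> (\<forall>i. y $ i \<in> domain_on (H i) (h i))"
  unfolding domain_on_def hilbert_sum_def by (auto simp: sum_Pinfty)

lemma subdifferential_on_hilbert_sumI:
  assumes v: "\<And>i. v $ i \<in> subdifferential_on (H i) (h i) (y $ i)"
  shows "v \<in> subdifferential_on (hilbert_sum H) (\<lambda>z. \<Sum>i\<in>UNIV. h i (z $ i)) y"
  unfolding subdifferential_on_def
proof (intro CollectI conjI ballI)
  show "v \<in> hilbert_sum H" using v unfolding subdifferential_on_def hilbert_sum_def by blast
  fix w assume w: "w \<in> hilbert_sum H"
  have "(\<Sum>i\<in>UNIV. h i (y $ i)) + ereal (v \<bullet> (w - y))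
      = (\<Sum>i\<in>UNIV. h i (y $ i) + ereal (v $ i \<bullet> (w $ i - y $ i)))"
    unfolding inner_vec_def sum.distrib by simp
  also have "\<dots> \<le> (\<Sum>i\<in>UNIV. h i (w $ i))"
    using v w unfolding subdifferential_on_def hilbert_sum_def by (intro sum_mono) simp
  finally show "(\<Sum>i\<in>UNIV. h i (y $ i)) + ereal (v \<bullet> (w - y)) \<le> (\<Sum>i\<in>UNIV. h i (w $ i))" .
qed

lemma winner_add_right: "winner \<gamma> x (y + z) = winner \<gamma> x y + winner \<gamma> x z"
  unfolding winner_def by (simp add: inner_add_right distrib_left sum.distrib)

lemma winner_commute: "winner \<gamma> x y = winner \<gamma> y x"
  unfolding winner_def by (simp add: inner_commute)

lemma wnorm_minus_commute: "wnorm \<gamma> (x - y) = wnorm \<gamma> (y - x)"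
  unfolding wnorm_def winner_def
  by (simp add: inner_diff_left inner_diff_right inner_commute algebra_simps)

lemma power2_wnorm:
  assumes "\<And>i. 0 < \<gamma> i"
  shows "(wnorm \<gamma> x)\<^sup>2 = winner \<gamma> x x"
proof -
  have "0 \<le> winner \<gamma> x x"
    unfolding winner_def using assms
    by (intro sum_nonneg mult_nonneg_nonneg) (auto simp: less_imp_le)
  then show ?thesis by (simp add: wnorm_def)
qed

lemma power2_wnorm_add:
  assumes "\<And>i. 0 < \<gamma> i"
  shows "(wnorm \<gamma> (x + y))\<^sup>2 = (wnorm \<gamma> x)\<^sup>2 + 2 * winner \<gamma> x y + (wnorm \<gamma> y)\<^sup>2"
  using winner_commute[of \<gamma> "x + y" x] winner_commute[of \<gamma> "x + y" y] winner_commute[of \<gamma> y x]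
  unfolding power2_wnorm[OF assms] by (simp add: winner_add_right)

lemma sum_norm_sq_le_wnorm:
  assumes \<gamma>: "\<And>i. 0 < \<gamma> i" and \<delta>: "\<And>i. \<gamma> i * \<nu> i \<le> \<delta>"
  shows "(\<Sum>i\<in>UNIV. \<nu> i * (norm (v $ i))\<^sup>2) \<le> \<delta> * (wnorm \<gamma> v)\<^sup>2"
  unfolding power2_wnorm[OF \<gamma>] winner_def sum_distrib_left
proof (rule sum_mono)
  fix i
  have "\<nu> i \<le> \<delta> / \<gamma> i" using \<gamma>[of i] \<delta>[of i] by (simp add: field_simps)
  then have "\<nu> i * (norm (v $ i))\<^sup>2 \<le> \<delta> / \<gamma> i * (norm (v $ i))\<^sup>2" by (rule mult_right_mono) simp
  then show "\<nu> i * (norm (v $ i))\<^sup>2 \<le> \<delta> * (1 / \<gamma> i * (v $ i \<bullet> v $ i))"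
    by (simp add: power2_norm_eq_inner)
qed

lemma finite_zero_one_vectors: "finite (zero_one_vectors :: (real ^ 'm::finite) set)"
proof -
  have "zero_one_vectors \<subseteq> range (\<lambda>A. (\<chi> i. indicator A i) :: real ^ 'm)"
  proof
    fix e :: "real ^ 'm" assume e: "e \<in> zero_one_vectors"
    have "e = (\<chi> i. indicator {i. e $ i = 1} i)"
      using e by (auto simp: vec_eq_iff zero_one_vectors_def indicator_def)
    then show "e \<in> range (\<lambda>A. (\<chi> i. indicator A i) :: real ^ 'm)" by blast
  qed
  then show ?thesis by (rule finite_subset) simp
qed

lemma block_step_nth:
  assumes "e \<in> zero_one_vectors"
  shows "(y + e \<odot> (q - y)) $ i = (if e $ i = 1 then q $ i else y $ i)"
  using assms by (auto simp: zero_one_vectors_def block_mult_def)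

lemma inner_block_mult: "g \<bullet> (e \<odot> v) = (\<Sum>i\<in>UNIV. e $ i * (g $ i \<bullet> v $ i))"
  by (simp add: inner_vec_def block_mult_def)

lemma (in prob_space) expectation_zero_one_vector_nth:
  assumes "eps \<in> measurable M (count_space zero_one_vectors)"
  shows "expectation (\<lambda>\<omega>. eps \<omega> $ i) = prob {\<omega> \<in> space M. eps \<omega> $ i = 1}"
proof -
  have "eps \<omega> $ i = indicator {\<omega> \<in> space M. eps \<omega> $ i = 1} \<omega>" if "\<omega> \<in> space M" for \<omega>
    using measurable_space[OF assms that] that by (auto simp: zero_one_vectors_def indicator_def)
  then have "expectation (\<lambda>\<omega>. eps \<omega> $ i)
      = expectation (indicator {\<omega> \<in> space M. eps \<omega> $ i = 1})"
    by (intro Bochner_Integration.integral_cong refl)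
  then show ?thesis by (simp add: Int_absorb2 Collect_conj_eq)
qed

lemma Min_mult_sum_le:
  fixes p a :: "'i \<Rightarrow> 'b::linordered_idom"
  assumes "finite A" "\<And>i. i \<in> A \<Longrightarrow> 0 \<le> a i"
  shows "Min (p ` A) * (\<Sum>i\<in>A. a i) \<le> (\<Sum>i\<in>A. p i * a i)"
  unfolding sum_distrib_left using assms by (intro sum_mono mult_right_mono) auto

subsection \<open>The block proximal gradient step\<close>

locale block_proximal_gradient =
  fixes H :: "'m::finite \<Rightarrow> 'a::real_inner set"
    and f :: "'a ^ 'm \<Rightarrow> real" and h :: "'m \<Rightarrow> 'a \<Rightarrow> ereal" and \<gamma> :: "'m \<Rightarrow> real"
  assumes subspace_H: "\<And>i. subspace (H i)"
    and complete_H: "\<And>i. Topological_Spaces.complete (H i)"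
    and f_diff: "f differentiable_on hilbert_sum H"
    and h_proper: "\<And>i. proper_on (H i) (h i)"
    and h_convex: "\<And>i. econvex_on (H i) (h i)"
    and h_lsc: "\<And>i. lsc_on (H i) (h i)"
    and \<gamma>_pos: "\<And>i. 0 < \<gamma> i"
begin

abbreviation grad :: "'a ^ 'm \<Rightarrow> 'a ^ 'm" where
  "grad \<equiv> gradient_on (hilbert_sum H) f"

definition h_sum :: "'a ^ 'm \<Rightarrow> ereal" where
  "h_sum y = (\<Sum>i\<in>UNIV. h i (y $ i))"

definition objective :: "'a ^ 'm \<Rightarrow> ereal" where
  "objective y = ereal (f y) + h_sum y"

abbreviation dom_h :: "('a ^ 'm) set" where
  "dom_h \<equiv> domain_on (hilbert_sum H) h_sum"

definition h_real :: "'m \<Rightarrow> 'a \<Rightarrow> real" where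
  "h_real i w = real_of_ereal (h i w)"

definition step :: "'a ^ 'm \<Rightarrow> 'a ^ 'm" where
  "step y = (\<chi> i. prox_on (H i) (\<lambda>w. ereal (\<gamma> i) * h i w) (y $ i - \<gamma> i *\<^sub>R grad y $ i))"

definition step_subgradient :: "'a ^ 'm \<Rightarrow> 'a ^ 'm" where
  "step_subgradient y = (\<chi> i. (1 / \<gamma> i) *\<^sub>R (y $ i - step y $ i) - grad y $ i)"

definition block_decrease :: "real \<Rightarrow> 'a ^ 'm \<Rightarrow> 'm \<Rightarrow> real" where
  "block_decrease L y i = h_real i (y $ i) - h_real i (step y $ i) - grad y $ i \<bullet> (step y - y) $ i
     - L / 2 * (norm ((step y - y) $ i))\<^sup>2"

lemma mem_dom_h_iff: "y \<in> dom_h \<longleftrightarrow> (\<forall>i. y $ i \<in> domain_on (H i) (h i))"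
  unfolding h_sum_def[abs_def] by (rule mem_domain_on_hilbert_sum_iff)

lemma dom_h_subset: "y \<in> dom_h \<Longrightarrow> y \<in> hilbert_sum H"
  by (simp add: domain_on_def)

lemma h_eq_h_real: "y \<in> dom_h \<Longrightarrow> h i (y $ i) = ereal (h_real i (y $ i))"
  using domain_on_ereal[OF h_proper] unfolding mem_dom_h_iff h_real_def by blast

lemma h_sum_eq_real: "y \<in> dom_h \<Longrightarrow> h_sum y = ereal (\<Sum>i\<in>UNIV. h_real i (y $ i))"
  by (simp add: h_sum_def h_eq_h_real)

lemma domain_objective: "domain_on (hilbert_sum H) objective = dom_h"
  unfolding domain_on_def objective_def by auto

lemma subspace_sum: "subspace (hilbert_sum H)"
  by (rule subspace_hilbert_sum[OF subspace_H])

lemma grad_mem: "y \<in> hilbert_sum H \<Longrightarrow> grad y \<in> hilbert_sum H"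
  using f_diff gradient_on_mem[OF subspace_sum complete_hilbert_sum[OF complete_H]]
  unfolding differentiable_on_def by blast

lemmas scaled_h_prox_hyps =
  complete_H proper_on_cmult[OF h_proper \<gamma>_pos]
  econvex_on_cmult[OF h_convex h_proper \<gamma>_pos] lsc_on_cmult[OF h_lsc \<gamma>_pos]

lemma step_mem_dom_h: "step y \<in> dom_h"
  unfolding mem_dom_h_iff step_def
  using prox_on_mem_domain[OF subspace_imp_convex[OF subspace_H] scaled_h_prox_hyps]
  by (simp add: domain_on_cmult \<gamma>_pos)

lemma step_subgradient_nth_mem:
  assumes "y \<in> hilbert_sum H"
  shows "step_subgradient y $ i \<in> subdifferential_on (H i) (h i) (step y $ i)"
proof -
  have "y $ i - \<gamma> i *\<^sub>R grad y $ i \<in> H i"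
    using assms grad_mem[OF assms] unfolding hilbert_sum_def
    by (auto intro!: subspace_diff[OF subspace_H] subspace_scale[OF subspace_H])
  note subdifferential_on_cmult[OF subspace_H \<gamma>_pos
      prox_on_residual_mem_subdifferential[OF subspace_H scaled_h_prox_hyps this]]
  moreover have "step_subgradient y $ i = (1 / \<gamma> i) *\<^sub>R (y $ i - \<gamma> i *\<^sub>R grad y $ i - step y $ i)"
    using \<gamma>_pos[of i] by (simp add: step_subgradient_def algebra_simps)
  ultimately show ?thesis by (simp add: step_def)
qed

lemma step_subgradient_mem:
  "y \<in> hilbert_sum H \<Longrightarrow> step_subgradient y \<in> subdifferential_on (hilbert_sum H) h_sum (step y)"
  unfolding h_sum_def[abs_def]
  by (intro subdifferential_on_hilbert_sumI step_subgradient_nth_mem)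

lemma inner_step_subgradient:
  "step_subgradient y \<bullet> d = winner \<gamma> (y - step y) d - grad y \<bullet> d"
  unfolding inner_vec_def winner_def sum_subtractf[symmetric]
  by (simp add: step_subgradient_def inner_diff_left)

lemma block_decrease_nonneg:
  assumes y: "y \<in> dom_h" and L: "\<gamma> i * L \<le> 2"
  shows "0 \<le> block_decrease L y i"
proof -
  let ?d = "(step y - y) $ i"
  have "h i (step y $ i) + ereal (step_subgradient y $ i \<bullet> (y $ i - step y $ i)) \<le> h i (y $ i)"
    using step_subgradient_nth_mem[OF dom_h_subset[OF y], of i] dom_h_subset[OF y]
    unfolding subdifferential_on_def hilbert_sum_def by blast
  then have "h_real i (step y $ i) + step_subgradient y $ i \<bullet> (y $ i - step y $ i)
      \<le> h_real i (y $ i)"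
    unfolding h_eq_h_real[OF y] h_eq_h_real[OF step_mem_dom_h] by simp
  moreover have "step_subgradient y $ i \<bullet> (y $ i - step y $ i)
      = 1 / \<gamma> i * (norm ?d)\<^sup>2 + grad y $ i \<bullet> ?d"
    unfolding power2_norm_eq_inner
    by (simp add: step_subgradient_def inner_diff_left inner_diff_right inner_commute algebra_simps)
  moreover have "L / 2 * (norm ?d)\<^sup>2 \<le> 1 / \<gamma> i * (norm ?d)\<^sup>2"
    using L \<gamma>_pos[of i] by (intro mult_right_mono) (auto simp: field_simps)
  ultimately show ?thesis unfolding block_decrease_def by linarith
qed

lemma sum_block_decrease:
  "(\<Sum>i\<in>UNIV. block_decrease (\<nu> i) y i)
    = (\<Sum>i\<in>UNIV. h_real i (y $ i)) - (\<Sum>i\<in>UNIV. h_real i (step y $ i)) - grad y \<bullet> (step y - y)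
      - 1/2 * (\<Sum>i\<in>UNIV. \<nu> i * (norm ((step y - y) $ i))\<^sup>2)"
  unfolding block_decrease_def inner_vec_def by (simp add: sum_subtractf sum_divide_distrib)

lemma block_step_mem_dom_h:
  assumes "y \<in> dom_h" "e \<in> zero_one_vectors"
  shows "y + e \<odot> (step y - y) \<in> dom_h"
  using assms(1) step_mem_dom_h[of y] unfolding mem_dom_h_iff block_step_nth[OF assms(2)] by auto

lemma objective_diff_block_step:
  assumes y: "y \<in> dom_h" and e: "e \<in> zero_one_vectors"
  shows "real_of_ereal (objective y - objective (y + e \<odot> (step y - y)))
    = f y - f (y + e \<odot> (step y - y))
      + (\<Sum>i\<in>UNIV. e $ i * (h_real i (y $ i) - h_real i (step y $ i)))"
proof -
  have "(\<Sum>i\<in>UNIV. h_real i (y $ i)) - (\<Sum>i\<in>UNIV. h_real i ((y + e \<odot> (step y - y)) $ i))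
      = (\<Sum>i\<in>UNIV. e $ i * (h_real i (y $ i) - h_real i (step y $ i)))"
    unfolding block_step_nth[OF e] sum_subtractf[symmetric]
    using e by (intro sum.cong refl) (auto simp: zero_one_vectors_def)
  then show ?thesis
    unfolding objective_def h_sum_eq_real[OF y] h_sum_eq_real[OF block_step_mem_dom_h[OF y e]]
    by simp
qed

lemma proximal_step_inequality:
  assumes y: "y \<in> dom_h" and z: "z \<in> dom_h" and \<delta>: "\<And>i. \<gamma> i * \<nu> i \<le> \<delta>"
    and \<mu>: "strong_convexity_modulus_smooth \<gamma> (hilbert_sum H) f \<mu>"
    and \<sigma>: "strong_convexity_modulus \<gamma> (hilbert_sum H) h_sum \<sigma>"
  shows "ereal ((1 + \<sigma>) * winner \<gamma> (y - step y) (z - y))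
    \<le> ereal (\<Sum>i\<in>UNIV. block_decrease (\<nu> i) y i)
      + (objective z - objective y - ereal ((\<mu> + \<sigma>) / 2 * (wnorm \<gamma> (y - z))\<^sup>2))
      + ereal ((\<delta> - 2 - \<sigma>) / 2 * (wnorm \<gamma> (y - step y))\<^sup>2)"
proof -
  let ?h = "\<lambda>w. \<Sum>i\<in>UNIV. h_real i (w $ i)" and ?q = "step y" and ?g = "grad y"
  note mem = dom_h_subset[OF y] dom_h_subset[OF z] dom_h_subset[OF step_mem_dom_h[of y]]
  have f_strong: "f y + ?g \<bullet> (z - y) + \<mu> / 2 * (wnorm \<gamma> (y - z))\<^sup>2 \<le> f z"
    using \<mu> mem unfolding strong_convexity_modulus_smooth_def wnorm_minus_commute[of \<gamma> y] by blast
  have "h_sum ?q + ereal (step_subgradient y \<bullet> (z - ?q))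
      + ereal (\<sigma> / 2 * (wnorm \<gamma> (z - ?q))\<^sup>2) \<le> h_sum z"
    using \<sigma> mem step_subgradient_mem[OF mem(1)] unfolding strong_convexity_modulus_def by blast
  then have h_strong: "?h ?q + winner \<gamma> (y - ?q) (z - ?q) - ?g \<bullet> (z - ?q)
      + \<sigma> / 2 * (wnorm \<gamma> (z - ?q))\<^sup>2 \<le> ?h z"
    unfolding h_sum_eq_real[OF step_mem_dom_h] h_sum_eq_real[OF z] inner_step_subgradient by simp
  have \<nu>_bound: "(\<Sum>i\<in>UNIV. \<nu> i * (norm ((?q - y) $ i))\<^sup>2) \<le> \<delta> * (wnorm \<gamma> (y - ?q))\<^sup>2"
    unfolding wnorm_minus_commute[of \<gamma> y ?q] by (rule sum_norm_sq_le_wnorm[OF \<gamma>_pos \<delta>])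
  have split: "z - ?q = (z - y) + (y - ?q)" by simp
  have inner_split: "winner \<gamma> (y - ?q) (z - ?q) = winner \<gamma> (y - ?q) (z - y) + (wnorm \<gamma> (y - ?q))\<^sup>2"
    unfolding split winner_add_right power2_wnorm[OF \<gamma>_pos] by simp
  have norm_split: "(wnorm \<gamma> (z - ?q))\<^sup>2
      = (wnorm \<gamma> (y - z))\<^sup>2 + 2 * winner \<gamma> (y - ?q) (z - y) + (wnorm \<gamma> (y - ?q))\<^sup>2"
    unfolding split power2_wnorm_add[OF \<gamma>_pos] wnorm_minus_commute[of \<gamma> y z]
      winner_commute[of \<gamma> "z - y" "y - ?q"] by simp
  have "?g \<bullet> (z - y) - ?g \<bullet> (z - ?q) = ?g \<bullet> (?q - y)" by (simp add: inner_diff_right)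
  then have "(1 + \<sigma>) * winner \<gamma> (y - ?q) (z - y)
      \<le> (\<Sum>i\<in>UNIV. block_decrease (\<nu> i) y i)
        + (f z + ?h z - (f y + ?h y) - (\<mu> + \<sigma>) / 2 * (wnorm \<gamma> (y - z))\<^sup>2)
        + (\<delta> - 2 - \<sigma>) / 2 * (wnorm \<gamma> (y - ?q))\<^sup>2"
    using f_strong h_strong \<nu>_bound unfolding sum_block_decrease inner_split norm_split
    by (simp add: field_simps)
  then show ?thesis unfolding objective_def h_sum_eq_real[OF y] h_sum_eq_real[OF z] by simp
qed

end

locale random_block_proximal_gradient = block_proximal_gradient H f h \<gamma> + prob_space M
  for H :: "'m::finite \<Rightarrow> 'a::real_inner set" and f h \<gamma> and M :: "'w measure" +
  fixes eps :: "'w \<Rightarrow> real ^ 'm" and p \<nu> :: "'m \<Rightarrow> real"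
  assumes eps_measurable: "eps \<in> measurable M (count_space zero_one_vectors)"
    and p_eq: "\<And>i. p i = prob {\<omega> \<in> space M. eps \<omega> $ i = 1}"
    and p_pos: "\<And>i. 0 < p i"
    and \<gamma>_\<nu>_le: "\<And>i. \<gamma> i * \<nu> i \<le> 2"
    and expected_smoothness: "\<And>y v. y \<in> hilbert_sum H \<Longrightarrow> v \<in> hilbert_sum H \<Longrightarrow>
      expectation (\<lambda>\<omega>. f (y + eps \<omega> \<odot> v))
        \<le> f y + expectation (\<lambda>\<omega>. grad y \<bullet> (eps \<omega> \<odot> v))
          + 1/2 * (\<Sum>i\<in>UNIV. p i * \<nu> i * (norm (v $ i))\<^sup>2)"
begin

lemma expected_objective_decrease:
  assumes y: "y \<in> dom_h"
  shows "(\<Sum>i\<in>UNIV. p i * block_decrease (\<nu> i) y i)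
    \<le> expectation (\<lambda>\<omega>. real_of_ereal (objective y - objective (y + eps \<omega> \<odot> (step y - y))))"
proof -
  let ?v = "step y - y" and ?\<Delta> = "\<lambda>i. h_real i (y $ i) - h_real i (step y $ i)"
  note integrable = integrable_finite_rv[OF eps_measurable finite_zero_one_vectors]
  note [simp] = integrable[of "\<lambda>e. e $ _"] integrable[of "\<lambda>e. f (y + e \<odot> ?v)"]
  have [simp]: "expectation (\<lambda>\<omega>. eps \<omega> $ i) = p i" for i
    unfolding p_eq by (rule expectation_zero_one_vector_nth[OF eps_measurable])
  have "?v \<in> hilbert_sum H"
    by (intro subspace_diff[OF subspace_sum] dom_h_subset step_mem_dom_h y)
  note smooth_y = expected_smoothness[OF dom_h_subset[OF y] this]
  have mean_grad: "expectation (\<lambda>\<omega>. grad y \<bullet> (eps \<omega> \<odot> ?v))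
      = (\<Sum>i\<in>UNIV. p i * (grad y $ i \<bullet> ?v $ i))"
    unfolding inner_block_mult by simp
  have "expectation (\<lambda>\<omega>. real_of_ereal (objective y - objective (y + eps \<omega> \<odot> ?v)))
      = expectation (\<lambda>\<omega>. f y - f (y + eps \<omega> \<odot> ?v) + (\<Sum>i\<in>UNIV. eps \<omega> $ i * ?\<Delta> i))"
    using measurable_space[OF eps_measurable]
    by (intro Bochner_Integration.integral_cong refl) (simp add: objective_diff_block_step[OF y])
  also have "\<dots> = f y - expectation (\<lambda>\<omega>. f (y + eps \<omega> \<odot> ?v)) + (\<Sum>i\<in>UNIV. p i * ?\<Delta> i)"
    by (simp add: prob_space)
  also have "\<dots> \<ge> (\<Sum>i\<in>UNIV. p i * ?\<Delta> i) - (\<Sum>i\<in>UNIV. p i * (grad y $ i \<bullet> ?v $ i))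
        - 1/2 * (\<Sum>i\<in>UNIV. p i * \<nu> i * (norm (?v $ i))\<^sup>2)"
    using smooth_y unfolding mean_grad by simp
  finally show ?thesis
    unfolding block_decrease_def sum_distrib_left sum_subtractf[symmetric]
    by (simp add: algebra_simps)
qed

lemma sum_block_decrease_le_expected:
  assumes y: "y \<in> dom_h"
  shows "(\<Sum>i\<in>UNIV. block_decrease (\<nu> i) y i)
    \<le> 1 / Min (range p)
      * expectation (\<lambda>\<omega>. real_of_ereal (objective y - objective (y + eps \<omega> \<odot> (step y - y))))"
proof -
  have "Min (range p) * (\<Sum>i\<in>UNIV. block_decrease (\<nu> i) y i)
      \<le> (\<Sum>i\<in>UNIV. p i * block_decrease (\<nu> i) y i)"
    by (rule Min_mult_sum_le) (simp_all add: block_decrease_nonneg[OF y \<gamma>_\<nu>_le])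
  also note expected_objective_decrease[OF y]
  finally show ?thesis using p_pos by (simp add: field_simps)
qed

lemma expected_proximal_step_inequality:
  assumes y: "y \<in> dom_h" and z: "z \<in> dom_h"
    and \<mu>: "strong_convexity_modulus_smooth \<gamma> (hilbert_sum H) f \<mu>"
    and \<sigma>: "strong_convexity_modulus \<gamma> (hilbert_sum H) h_sum \<sigma>"
  shows "ereal ((1 + \<sigma>) * winner \<gamma> (y - step y) (z - y))
    \<le> ereal (1 / Min (range p)
        * (\<integral>e. real_of_ereal (objective y - objective (y + e \<odot> (step y - y)))
            \<partial>distr M (count_space zero_one_vectors) eps))
      + (objective z - objective y - ereal ((\<mu> + \<sigma>) / 2 * (wnorm \<gamma> (y - z))\<^sup>2))
      + ereal ((Max (range (\<lambda>i. \<gamma> i * \<nu> i)) - 2 - \<sigma>) / 2 * (wnorm \<gamma> (y - step y))\<^sup>2)"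
  unfolding integral_distr[OF eps_measurable borel_measurable_count_space]
proof (rule order_trans)
  show "ereal ((1 + \<sigma>) * winner \<gamma> (y - step y) (z - y))
    \<le> ereal (\<Sum>i\<in>UNIV. block_decrease (\<nu> i) y i)
      + (objective z - objective y - ereal ((\<mu> + \<sigma>) / 2 * (wnorm \<gamma> (y - z))\<^sup>2))
      + ereal ((Max (range (\<lambda>i. \<gamma> i * \<nu> i)) - 2 - \<sigma>) / 2 * (wnorm \<gamma> (y - step y))\<^sup>2)"
    by (rule proximal_step_inequality[OF y z _ \<mu> \<sigma>]) simp
qed (use sum_block_decrease_le_expected[OF y] in \<open>intro add_right_mono, simp\<close>)

end

theorem proposition4p4:
  fixes H :: "'m::finite \<Rightarrow> 'a::real_inner set"
    and f :: "'a ^ 'm \<Rightarrow> real"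
    and h :: "'m \<Rightarrow> 'a \<Rightarrow> ereal"
    and hsum F :: "'a ^ 'm \<Rightarrow> ereal"
    and M :: "'w measure"
    and eps :: "'w \<Rightarrow> real ^ 'm"
    and epsn :: "nat \<Rightarrow> 'w \<Rightarrow> real ^ 'm"
    and p \<nu> \<gamma> :: "'m \<Rightarrow> real"
    and x0 :: "'a ^ 'm"
    and x xbar :: "nat \<Rightarrow> 'w \<Rightarrow> 'a ^ 'm"
    and \<delta> pmin \<mu> \<sigma> :: real
  assumes H: "\<And>i. separable_hilbert (H i)"
    and f_convex: "convex_on (hilbert_sum H) f"
    and f_diff: "f differentiable_on hilbert_sum H"
    and h_proper: "\<And>i. proper_on (H i) (h i)"
    and h_convex: "\<And>i. econvex_on (H i) (h i)"
    and h_lsc: "\<And>i. lsc_on (H i) (h i)"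
    and hsum: "\<And>z. hsum z = (\<Sum>i\<in>UNIV. h i (z $ i))"
    and F: "\<And>z. F z = ereal (f z) + hsum z"
    and M: "prob_space M"
    and eps_rv: "eps \<in> measurable M (count_space zero_one_vectors)"
    and p: "\<And>i. p i = measure M {\<omega> \<in> space M. eps \<omega> $ i = 1}"
    and p_pos: "\<And>i. p i > 0"
    and eps_nonzero: "measure M {\<omega> \<in> space M. eps \<omega> = 0} = 0"
    and epsn_indep: "prob_space.indep_vars M (\<lambda>_. count_space zero_one_vectors) epsn UNIV"
    and epsn_copies: "\<And>n. distr M (count_space zero_one_vectors) (epsn n)
                         = distr M (count_space zero_one_vectors) eps"
    and \<nu>_pos: "\<And>i. \<nu> i > 0"
    and smoothness: "\<And>z v. z \<in> hilbert_sum H \<Longrightarrow> v \<in> hilbert_sum H \<Longrightarrow>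
          (\<integral>\<omega>. f (z + eps \<omega> \<odot> v) \<partial>M)
            \<le> f z + (\<integral>\<omega>. gradient_on (hilbert_sum H) f z \<bullet> (eps \<omega> \<odot> v) \<partial>M)
                + 1/2 * (\<Sum>i\<in>UNIV. p i * \<nu> i * (norm (v $ i))\<^sup>2)"
    and \<gamma>: "\<And>i. 0 < \<gamma> i" "\<And>i. \<gamma> i < 2 / \<nu> i"
    and x0: "x0 \<in> domain_on (hilbert_sum H) hsum"
    and x_0: "\<And>\<omega>. \<omega> \<in> space M \<Longrightarrow> x 0 \<omega> = x0"
    and xbar_Suc: "\<And>n \<omega>. \<omega> \<in> space M \<Longrightarrow>
          xbar (Suc n) \<omega> = (\<chi> i. prox_on (H i) (\<lambda>z. ereal (\<gamma> i) * h i z)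
             (x n \<omega> $ i - \<gamma> i *\<^sub>R (gradient_on (hilbert_sum H) f (x n \<omega>) $ i)))"
    and x_Suc: "\<And>n \<omega>. \<omega> \<in> space M \<Longrightarrow>
          x (Suc n) \<omega> = x n \<omega> + epsn n \<omega> \<odot> (xbar (Suc n) \<omega> - x n \<omega>)"
    and \<delta>: "\<delta> = Max (range (\<lambda>i. \<gamma> i * \<nu> i))"
    and pmin: "pmin = Min (range p)"
    and \<mu>: "strong_convexity_modulus_smooth \<gamma> (hilbert_sum H) f \<mu>"
    and \<sigma>: "strong_convexity_modulus \<gamma> (hilbert_sum H) hsum \<sigma>"
  shows "\<forall>n. \<forall>z \<in> domain_on (hilbert_sum H) F. AE \<omega> in M.
      ereal ((1 + \<sigma>) * winner \<gamma> (x n \<omega> - xbar (Suc n) \<omega>) (z - x n \<omega>))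
        \<le> ereal (1 / pmin * real_cond_exp M (history M (count_space zero_one_vectors) epsn n)
                   (\<lambda>\<omega>'. real_of_ereal (F (x n \<omega>') - F (x (Suc n) \<omega>'))) \<omega>)
          + (F z - F (x n \<omega>) - ereal ((\<mu> + \<sigma>) / 2 * (wnorm \<gamma> (x n \<omega> - z))\<^sup>2))
          + ereal ((\<delta> - 2 - \<sigma>) / 2 * (wnorm \<gamma> (x n \<omega> - xbar (Suc n) \<omega>))\<^sup>2)"
proof (intro allI ballI, goal_cases inequality)
  case (inequality n z)
  have "\<gamma> i * \<nu> i \<le> 2" for i using \<gamma>(2)[of i] \<nu>_pos[of i] by (simp add: field_simps)
  then interpret bpg: random_block_proximal_gradient H f h \<gamma> M eps p \<nu>
    by (intro random_block_proximal_gradient.intro block_proximal_gradient.intro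
          random_block_proximal_gradient_axioms.intro M eps_rv p p_pos smoothness
          f_diff h_proper h_convex h_lsc \<gamma>(1))
       (use H in \<open>simp_all add: separable_hilbert_def\<close>)
  have hsum_eq: "hsum = bpg.h_sum" and F_eq: "F = bpg.objective"
    by (simp_all add: fun_eq_iff hsum F bpg.h_sum_def bpg.objective_def)
  have xbar: "xbar (Suc k) \<omega> = bpg.step (x k \<omega>)" if "\<omega> \<in> space M" for k \<omega>
    using xbar_Suc[OF that] by (simp add: bpg.step_def)
  interpret iter: random_recursion M zero_one_vectors epsn "\<lambda>y e. y + e \<odot> (bpg.step y - y)" x x0
    by (intro random_recursion.intro M random_recursion_axioms.intro
          finite_zero_one_vectors epsn_indep x_0)
       (simp_all add: x_Suc xbar)
  show ?case
    using iter.real_cond_exp_transition[of n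
        "\<lambda>y y'. real_of_ereal (bpg.objective y - bpg.objective y')"] AE_space
  proof eventually_elim
    case (elim \<omega>)
    have "x n \<omega> \<in> bpg.dom_h"
      using iter.state_mem_invariant x0 bpg.block_step_mem_dom_h elim(2) unfolding hsum_eq by blast
    then show ?case
      using bpg.expected_proximal_step_inequality \<mu> \<sigma> inequality
      unfolding elim(1) xbar[OF elim(2)] F_eq hsum_eq bpg.domain_objective epsn_copies pmin \<delta>
      by blast
  qed
qed

end
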